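(* Let $p,d,N$ be positive integers with $d<p$ and $N>p$. Let $\mathcal{R}\in\mathbb{R}^{p\times N}$ have singular values $\sigma_1\ge\sigma_2\ge\cdots\ge\sigma_d>\sigma_{d+1}\ge\cdots\ge\sigma_p$. Let $\mathcal{U}_d\in\mathbb{R}^{p\times d}$ be the matrix whose columns are the $d$ leading principal components $\mathrm{PC}_1,\dots,\mathrm{PC}_d$ of $\mathcal{R}$. Let $U_0\in\mathbb{R}^{p\times d}$ satisfy $\operatorname{rank}(U_0^T\mathcal{U}_d)=d$. Let $(U_k^{LS})_{k\ge0}$ be the iterates of the iterative least-squares algorithm applied to $\mathcal{R}$, initialized with $U_0^{LS}=U_0$, and let $(U_k^{SI})_{k\ge 0}$ be the iterates of subspace iteration applied to the matrix $\mathcal{R}\mathcal{R}^T$, initialized with $U_0^{SI}=U_0$. Then for every $k\ge 0$, $$\operatorname{Col}(U_k^{LS})=\operatorname{Col}(U_k^{SI}).$$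
   Context: $\operatorname{Col}(M)$ is the column space of a matrix $M$; $\|\cdot\|$ is the Euclidean norm and $\|\cdot\|_F$ the Frobenius norm. The singular values $\sigma_1\ge\dots\ge\sigma_p\ge 0$ of $\mathcal{R}\in\mathbb{R}^{p\times N}$ are the square roots of the eigenvalues of $\mathcal{R}\mathcal{R}^T$, with multiplicity. Principal components of $\mathcal{R}$: $\mathrm{PC}_1$ is a maximizer of $\|w^T\mathcal{R}\|^2$ over unit vectors $w\in\mathbb{R}^p$, and for $k>1$, $\mathrm{PC}_k$ is a maximizer of $\|w^T\mathcal{R}\|^2$ over unit vectors $w$ orthogonal to $\operatorname{span}\{\mathrm{PC}_1,\dots,\mathrm{PC}_{k-1}\}$. Equivalently, $\mathrm{PC}_1,\dots,\mathrm{PC}_p$ is an orthonormal basis of eigenvectors of $\mathcal{R}\mathcal{R}^T$ with eigenvalues $\sigma_1^2\ge\dots\ge\sigma_p^2$ respectively (any choice is allowed when eigenvalues are repeated). For $A\in\mathbb{R}^{p\times d}$, $\mathrm{GS}(A)\in\mathbb{R}^{p\times d}$ denotes the result of the (normalized) Gram–Schmidt process on the columns of $A$; its columns span $\operatorname{Col}(A)$, and they are orthonormal when the columns of $A$ are linearly independent. Iterative least-squares algorithm for $\mathcal{R}$ (run without a stopping rule): given $U_k$, set $X_k=U_k^T\mathcal{R}\in\mathbb{R}^{d\times N}$; let $A_{k+1}$ be a minimizer of $\|\mathcal{R}-AX_k\|_F^2$ over $A\in\mathbb{R}^{p\times d}$ (equivalently, a solution of $A X_kX_k^T=\mathcal{R}X_k^T$);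 set $U_{k+1}=\mathrm{GS}(A_{k+1})$. Subspace iteration for a matrix $M\in\mathbb{R}^{p\times p}$ (run without a stopping rule): given $U_k\in\mathbb{R}^{p\times d}$, set $U_{k+1}=\mathrm{GS}(MU_k)$. *)

theory Defs
  imports
    Complex_Main
    "Jordan_Normal_Form.Char_Poly"
    "Jordan_Normal_Form.Gram_Schmidt"
    "Jordan_Normal_Form.DL_Rank"
begin

definition euclidean_norm :: "real vec \<Rightarrow> real" where
  "euclidean_norm v = sqrt (\<Sum>i<dim_vec v. (v $ i)\<^sup>2)"

definition frobenius_norm :: "real mat \<Rightarrow> real" where
  "frobenius_norm A = sqrt (\<Sum>i<dim_row A. \<Sum>j<dim_col A. (A $$ (i, j))\<^sup>2)"

abbreviation vec_span :: "nat \<Rightarrow> real vec set \<Rightarrow> real vec set" where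
  "vec_span n S \<equiv> LinearCombinations.module.span class_ring (module_vec TYPE(real) n) S"

abbreviation Col :: "real mat \<Rightarrow> real vec set" where
  "Col A \<equiv> vec_space.col_space (dim_row A) A"

abbreviation mat_rank :: "real mat \<Rightarrow> nat" where
  "mat_rank A \<equiv> vec_space.rank (dim_row A) A"

text \<open>
  Singular values and principal components are indexed from 1. The equation for the
  characteristic polynomial says that the squares of the numbers \<open>\<sigma> 1, \<dots>, \<sigma> p\<close> are
  the eigenvalues of \<open>R * R\<^sup>T\<close>, counted with multiplicity.
\<close>

definition is_singular_values :: "real mat \<Rightarrow> (nat \<Rightarrow> real) \<Rightarrow> bool" where
  "is_singular_values R \<sigma> \<longleftrightarrow>
     (\<forall>i\<in>{1..dim_row R}. 0 \<le> \<sigma> i) \<and>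
     (\<forall>i\<in>{1..dim_row R}. \<forall>j\<in>{1..dim_row R}. i \<le> j \<longrightarrow> \<sigma> j \<le> \<sigma> i) \<and>
     char_poly (R * R\<^sup>T) = (\<Prod>i\<in>{1..dim_row R}. [:- ((\<sigma> i)\<^sup>2), 1:])"

text \<open>
  The row vector \<open>w\<^sup>T R\<close> is rendered as the vector \<open>R\<^sup>T *\<^sub>v w\<close>.
\<close>

definition is_principal_components :: "real mat \<Rightarrow> nat \<Rightarrow> (nat \<Rightarrow> real vec) \<Rightarrow> bool" where
  "is_principal_components R m PC \<longleftrightarrow>
     (\<forall>k\<in>{1..m}. is_arg_max
        (\<lambda>w. (euclidean_norm (R\<^sup>T *\<^sub>v w))\<^sup>2)
        (\<lambda>w. w \<in> carrier_vec (dim_row R) \<and> euclidean_norm w = 1 \<and>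
             (\<forall>v\<in>vec_span (dim_row R) (PC ` {1..<k}). w \<bullet> v = 0))
        (PC k))"

definition pc_matrix :: "nat \<Rightarrow> nat \<Rightarrow> (nat \<Rightarrow> real vec) \<Rightarrow> real mat" where
  "pc_matrix p d PC = mat_of_cols p (map PC [1..<d + 1])"

text \<open>
  \<open>gram_schmidt\<close> orthogonalizes without normalizing. If a column depends linearly on the
  preceding ones, it is replaced by the zero vector, and the normalization leaves this
  zero column unchanged because \<open>1 / 0 = 0\<close>.
\<close>

definition GS :: "real mat \<Rightarrow> real mat" where
  "GS A = mat_of_cols (dim_row A)
     (map (\<lambda>v. (1 / euclidean_norm v) \<cdot>\<^sub>v v) (gram_schmidt (dim_row A) (cols A)))"

text \<open>
  The least-squares minimizer need not be unique a priori, so the algorithm is given as a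
  relation: \<open>U\<close> is a possible sequence of iterates for \<open>R\<close>.
\<close>

definition is_least_squares_iterates :: "real mat \<Rightarrow> real mat \<Rightarrow> (nat \<Rightarrow> real mat) \<Rightarrow> bool" where
  "is_least_squares_iterates R U0 U \<longleftrightarrow>
     U 0 = U0 \<and>
     (\<forall>k. let X = (U k)\<^sup>T * R in
        \<exists>A. is_arg_min (\<lambda>A. (frobenius_norm (R - A * X))\<^sup>2)
              (\<lambda>A. A \<in> carrier_mat (dim_row R) (dim_col U0)) A \<and>
            U (Suc k) = GS A)"

primrec subspace_iterates :: "real mat \<Rightarrow> real mat \<Rightarrow> nat \<Rightarrow> real mat" where
  "subspace_iterates M U0 0 = U0"
| "subspace_iterates M U0 (Suc k) = GS (M * subspace_iterates M U0 k)"

end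

theory Submission
  imports Defs "Jordan_Normal_Form.Schur_Decomposition"
begin

text \<open>
  Write \<open>M = R * R\<^sup>T\<close>. One step of either algorithm replaces the column space \<open>C\<close> of the
  current iterate by its image under \<open>M\<close>, so the column spaces agree forever once they agree
  at the start. For subspace iteration this is clear, since Gram--Schmidt keeps the column
  space. For least squares, the minimizer \<open>A\<close> satisfies the normal equations
  \<open>A * (X * X\<^sup>T) = R * X\<^sup>T\<close>
  (\<open>least_squares_normal_equations\<close>), and with \<open>X = U\<^sup>T * R\<close> they read
  \<open>A * (X * X\<^sup>T) = M * U\<close>. If the Gram matrix \<open>X * X\<^sup>T\<close> is invertible, \<open>A\<close> and \<open>M * U\<close>
  have the same column space.

  The leading principal components supply this invertibility. Let \<open>W\<close> be the transpose of
  the matrix of these components. They are eigenvectors of \<open>M\<close>, so \<open>W * M = L * W\<close> with \<open>L\<close>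
  the diagonal matrix of their eigenvalues. Multiplying the normal equations by \<open>W\<close> and taking
  determinants gives
  \<open>det (W * A) * det (X * X\<^sup>T) = det L * det (W * U)\<close>,
  so if \<open>det L\<close> and \<open>det (W * U)\<close> are nonzero, then both factors on the left are
  (\<open>least_squares_step\<close>): the first factor passes the condition on to the next iterate, the second
  is the invertibility wanted. The condition \<open>det (W * U) \<noteq> 0\<close> depends on the column space of
  \<open>U\<close> only (\<open>det_mult_nonzero_Col_cong\<close>), hence Gram--Schmidt does not disturb it, and it also
  implies that the columns of \<open>U\<close> are independent. At the start it is the rank hypothesis
  on \<open>U0\<close>.

  It remains to see that each component is an eigenvector with a positive eigenvalue
  (\<open>principal_component_eigenvector\<close>). Eigenvector: the first-order condition at a
  maximum of the quadratic form of \<open>M\<close> on a subspace that \<open>M\<close> maps into itself. Positive: the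
  gap below \<open>\<sigma> d\<close> makes \<open>\<sigma> 1, \<dots>, \<sigma> d\<close> positive, so \<open>M\<close> has rank at least
  \<open>d\<close> and cannot vanish on the orthogonal complement of fewer than \<open>d\<close> vectors
  (\<open>exists_orthogonal_vec_not_in_kernel\<close>).
\<close>

section \<open>Column spaces\<close>

lemma Col_eq_image:
  "Col A = (\<lambda>x. A *\<^sub>v x) ` carrier_vec (dim_col A)"
proof -
  interpret vec_space "TYPE(real)" "dim_row A" .
  have A: "A \<in> carrier_mat (dim_row A) (dim_col A)"
    by simp
  have "A *\<^sub>v x \<in> carrier_vec (dim_row A)" for x
    unfolding carrier_vec_def by simp
  then show ?thesis
    unfolding col_space_eq[OF A] by blast
qed

lemma Col_mult:
  assumes "A \<in> carrier_mat n m" and "B \<in> carrier_mat m l"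
  shows "Col (A * B) = (\<lambda>x. A *\<^sub>v x) ` Col B"
proof -
  have "(A * B) *\<^sub>v x = A *\<^sub>v (B *\<^sub>v x)" if "x \<in> carrier_vec l" for x
    using assms that by simp
  then show ?thesis
    using assms unfolding Col_eq_image image_image by (intro image_cong) auto
qed

text \<open>
  This turns nonvanishing of a determinant into a property of a column space, which is what
  makes the invariant of the iteration independent of the chosen basis.
\<close>

lemma det_nonzero_iff_Col:
  fixes Z :: "real mat"
  assumes Z: "Z \<in> carrier_mat n n"
  shows "det Z \<noteq> 0 \<longleftrightarrow> Col Z = carrier_vec n"
proof
  assume "det Z \<noteq> 0"
  from det_non_zero_imp_unit[OF Z this, of "()"]
  obtain Y where Y: "Y \<in> carrier_mat n n" "Z * Y = 1\<^sub>m n"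
    unfolding Units_def ring_mat_def by auto
  have "y = Z *\<^sub>v (Y *\<^sub>v y)" if "y \<in> carrier_vec n" for y
    using that Y Z by (metis assoc_mult_mat_vec one_mult_mat_vec)
  then have "y \<in> Col Z" if "y \<in> carrier_vec n" for y
    unfolding Col_eq_image using that Y Z by (metis carrier_matD(2) imageI mult_mat_vec_carrier)
  then show "Col Z = carrier_vec n"
    unfolding Col_eq_image using Z by auto
next
  assume C: "Col Z = carrier_vec n"
  interpret vec_space "TYPE(real)" n .
  have "span (set (cols Z)) = carrier_vec n"
    using C Z by (simp add: col_space_def)
  then have "rank Z = dim"
    unfolding rank_def by (simp add: module_vec_def)
  then show "det Z \<noteq> 0"
    using det_rank_iff[OF Z] dim_is_n by simp
qed

lemma Col_mult_invertible:
  assumes A: "A \<in> carrier_mat n m" and B: "B \<in> carrier_mat m m" and "det B \<noteq> 0"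
  shows "Col (A * B) = Col A"
proof -
  have "Col B = carrier_vec m"
    using assms det_nonzero_iff_Col by blast
  then show ?thesis
    using A unfolding Col_mult[OF A B] Col_eq_image[of A] by simp
qed

text \<open>
  The column space of \<open>W * A\<close> is the image under \<open>W\<close> of that of \<open>A\<close>.
\<close>

lemma det_mult_nonzero_Col_cong:
  assumes W: "W \<in> carrier_mat d p" and A: "A \<in> carrier_mat p d" and B: "B \<in> carrier_mat p d"
    and "Col A = Col B" and "det (W * A) \<noteq> 0"
  shows "det (W * B) \<noteq> 0"
proof -
  have "Col (W * A) = Col (W * B)"
    unfolding Col_mult[OF W A] Col_mult[OF W B] by (simp only: assms(4))
  then show ?thesis
    using assms det_nonzero_iff_Col[of "W * A" d] det_nonzero_iff_Col[of "W * B" d] by auto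
qed

text \<open>
  A linear relation between the columns of \<open>A\<close> is also one between those of \<open>W * A\<close>.
  Distinctness is stated apart because independence concerns the set of columns and does
  not see repetitions.
\<close>

lemma cols_independent_if_det_mult_nonzero:
  fixes W A :: "real mat"
  assumes W: "W \<in> carrier_mat d p" and A: "A \<in> carrier_mat p d" and det: "det (W * A) \<noteq> 0"
  shows "distinct (cols A)"
    and "\<not> LinearCombinations.module.lin_dep class_ring (module_vec TYPE(real) p) (set (cols A))"
proof -
  interpret vec_space "TYPE(real)" p .
  have WA: "W * A \<in> carrier_mat d d"
    using W A by simp
  show dist: "distinct (cols A)"
  proof (rule ccontr)
    assume "\<not> distinct (cols A)"
    then obtain i j where ij: "i \<noteq> j" "i < d" "j < d" "col A i = col A j"
      using A by (auto simp: distinct_conv_nth)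
    then have "col (W * A) i = col (W * A) j"
      using W A by (simp add: col_mult2)
    then show False
      using det_identical_cols[OF WA ij(1-3)] det by simp
  qed
  show "lin_indpt (set (cols A))"
  proof
    assume "lin_dep (set (cols A))"
    from lin_depE[OF A this dist] obtain v
      where v: "v \<in> carrier_vec d" "v \<noteq> 0\<^sub>v d" "A *\<^sub>v v = 0\<^sub>v p" .
    then have "(W * A) *\<^sub>v v = W *\<^sub>v 0\<^sub>v p"
      by (simp add: assoc_mult_mat_vec[OF W A])
    also have "\<dots> = 0\<^sub>v d"
      using W by (intro eq_vecI) auto
    finally have "(W * A) *\<^sub>v v = 0\<^sub>v d" .
    then show False
      using det det_0_iff_vec_prod_zero_field[OF WA] v by blast
  qed
qed

section \<open>Euclidean norm and Gram--Schmidt\<close>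

lemma euclidean_norm_sq: "(euclidean_norm v)\<^sup>2 = v \<bullet> v"
  unfolding euclidean_norm_def scalar_prod_def
  by (simp add: sum_nonneg power2_eq_square atLeast0LessThan)

lemma euclidean_norm_eq_1_iff: "euclidean_norm v = 1 \<longleftrightarrow> v \<bullet> v = 1"
proof -
  have "euclidean_norm v \<ge> 0"
    unfolding euclidean_norm_def by (simp add: sum_nonneg)
  then show ?thesis
    using euclidean_norm_sq[of v] by (metis abs_of_nonneg one_power2 real_sqrt_abs real_sqrt_one)
qed

lemma scalar_prod_self_pos:
  fixes v :: "real vec"
  assumes "v \<in> carrier_vec n" and "v \<noteq> 0\<^sub>v n"
  shows "0 < v \<bullet> v"
  using conjugate_square_greater_0_vec[OF assms(1)] assms by simp

lemma det_mat_diag: "det (mat_diag n f) = (\<Prod>i = 0..<n. f i)"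
proof -
  have "upper_triangular (mat_diag n f)"
    unfolding mat_diag_def by auto
  then have "det (mat_diag n f) = prod_list (diag_mat (mat_diag n f))"
    by (rule det_upper_triangular[OF _ mat_diag_dim])
  also have "\<dots> = (\<Prod>i = 0..<n. f i)"
    unfolding prod_list_diag_prod by (simp add: mat_diag_def)
  finally show ?thesis .
qed

text \<open>
  For independent columns, Gram--Schmidt keeps the span and returns nonzero orthogonal vectors.
  Normalizing them is right multiplication by an invertible diagonal matrix.
\<close>

lemma
  assumes W: "W \<in> carrier_mat d p" and A: "A \<in> carrier_mat p d" and det: "det (W * A) \<noteq> 0"
  shows GS_carrier: "GS A \<in> carrier_mat p d"
    and Col_GS: "Col (GS A) = Col A"
proof -
  interpret cof_vec_space p "TYPE(real)" .
  define us where "us = gram_schmidt p (cols A)"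
  have cA: "set (cols A) \<subseteq> carrier_vec p"
    using A cols_dim by blast
  note gs = gram_schmidt_result[OF cA cols_independent_if_det_mult_nonzero[OF W A det] us_def]
  have len: "length us = d"
    using gs(4) A by simp
  have us_i: "us ! i \<in> carrier_vec p" if "i < d" for i
    using gs(3) len that by auto
  define D where "D = mat_diag d (\<lambda>i. 1 / euclidean_norm (us ! i))"
  define Q where "Q = mat_of_cols p us"
  have Q: "Q \<in> carrier_mat p d" and D: "D \<in> carrier_mat d d"
    unfolding Q_def D_def using len by auto
  have GS: "GS A = Q * D"
  proof (rule eq_matI)
    show "dim_row (GS A) = dim_row (Q * D)" "dim_col (GS A) = dim_col (Q * D)"
      using A Q D len unfolding GS_def us_def by auto
  next
    fix i j assume "i < dim_row (Q * D)" "j < dim_col (Q * D)"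
    then have ij: "i < p" "j < d"
      using Q D by auto
    have "GS A $$ (i, j) = us ! j $ i / euclidean_norm (us ! j)"
      using A ij len us_i[OF ij(2)] unfolding GS_def us_def by (simp add: mat_of_cols_index)
    also have "\<dots> = (Q * D) $$ (i, j)"
      using ij len unfolding D_def mat_diag_mult_right[OF Q] by (simp add: Q_def mat_of_cols_index)
    finally show "GS A $$ (i, j) = (Q * D) $$ (i, j)" .
  qed
  show "GS A \<in> carrier_mat p d"
    unfolding GS using Q D by simp
  have norm_nz: "euclidean_norm (us ! i) \<noteq> 0" if "i < d" for i
  proof
    assume "euclidean_norm (us ! i) = 0"
    then have "us ! i \<bullet> us ! i = 0"
      using euclidean_norm_sq[of "us ! i"] by simp
    then show False
      using corthogonalD[OF gs(2), of i i] that len by simp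
  qed
  have "det D = (\<Prod>i = 0..<d. 1 / euclidean_norm (us ! i))"
    unfolding D_def by (rule det_mat_diag)
  then have "det D \<noteq> 0"
    using norm_nz by simp
  from Col_mult_invertible[OF Q D this] have "Col (GS A) = Col Q"
    unfolding GS .
  also have "Col Q = Col A"
    using A gs(1,3) by (simp add: col_space_def Q_def)
  finally show "Col (GS A) = Col A" .
qed



section \<open>The least-squares step\<close>

text \<open>
  The algebraic form of a first-order condition: near \<open>t = 0\<close> the linear term, unless it is zero,
  outweighs the quadratic one. Both variational arguments below end with it.
\<close>

lemma linear_le_quadratic_imp_zero:
  fixes a b :: real
  assumes "\<And>t. t * a \<le> t\<^sup>2 * b"
  shows "a = 0"
proof (rule ccontr)
  assume "a \<noteq> 0"
  \<comment> \<open>A step of size \<open>a / c\<close> with \<open>c\<close> above \<open>b\<close> violates the inequality.\<close>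
  define c where "c = \<bar>b\<bar> + 1"
  have c: "0 < c" "b < c"
    unfolding c_def by auto
  have "(a / c) * a \<le> (a / c)\<^sup>2 * b"
    by (rule assms)
  then have "a\<^sup>2 * c \<le> a\<^sup>2 * b"
    using c by (simp add: field_simps power2_eq_square)
  then show False
    using c \<open>a \<noteq> 0\<close> by simp
qed

lemma frobenius_norm_sq:
  "(frobenius_norm A)\<^sup>2 = (\<Sum>i<dim_row A. \<Sum>j<dim_col A. (A $$ (i, j))\<^sup>2)"
  unfolding frobenius_norm_def by (simp add: sum_nonneg)

text \<open>
  With \<open>D = R - A * X\<close>, the gradient of the objective at \<open>A\<close> is \<open>-2 * G\<close> for
  \<open>G = D * X\<^sup>T\<close>. Moving from \<open>A\<close> in the direction \<open>G\<close> must not decrease the objective; the linear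
  term of this change is \<open>-2\<close> times the squared Frobenius norm of \<open>G\<close>, so \<open>G = 0\<close>.
\<close>

lemma least_squares_normal_equations:
  assumes R: "R \<in> carrier_mat p N" and X: "X \<in> carrier_mat d N"
    and min: "is_arg_min (\<lambda>A. (frobenius_norm (R - A * X))\<^sup>2) (\<lambda>A. A \<in> carrier_mat p d) A"
  shows "A * (X * X\<^sup>T) = R * X\<^sup>T"
proof -
  have le: "(frobenius_norm (R - A * X))\<^sup>2 \<le> (frobenius_norm (R - B * X))\<^sup>2"
    if "B \<in> carrier_mat p d" for B
    using min that unfolding is_arg_min_linorder by auto
  have A: "A \<in> carrier_mat p d"
    using min unfolding is_arg_min_linorder by auto
  define D where "D = R - A * X"
  define G where "G = D * X\<^sup>T"
  define F where "F = G * X"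
  have D: "D \<in> carrier_mat p N"
    unfolding D_def using mult_carrier_mat[OF A X] by (rule minus_carrier_mat)
  have G: "G \<in> carrier_mat p d"
    unfolding G_def using D X by simp
  have F: "F \<in> carrier_mat p N"
    unfolding F_def using G X by simp
  define a where "a = (\<Sum>i<p. \<Sum>j<N. D $$ (i, j) * F $$ (i, j))"
  define b where "b = (\<Sum>i<p. \<Sum>j<N. (F $$ (i, j))\<^sup>2)"
  have F_index: "F $$ (i, j) = (\<Sum>l<d. G $$ (i, l) * X $$ (l, j))" if "i < p" "j < N" for i j
    using that G X unfolding F_def by (simp add: scalar_prod_def atLeast0LessThan)
  have G_index: "G $$ (i, l) = (\<Sum>j<N. D $$ (i, j) * X $$ (l, j))" if "i < p" "l < d" for i l
    using that D X unfolding G_def by (simp add: scalar_prod_def atLeast0LessThan)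
  \<comment> \<open>The inner product of \<open>D\<close> with \<open>G * X\<close> equals that of \<open>D * X\<^sup>T = G\<close> with \<open>G\<close>.\<close>
  have a_eq: "a = (\<Sum>i<p. \<Sum>l<d. (G $$ (i, l))\<^sup>2)"
    unfolding a_def
  proof (rule sum.cong[OF refl])
    fix i assume "i \<in> {..<p}"
    then have i: "i < p"
      by simp
    have "(\<Sum>j<N. D $$ (i, j) * F $$ (i, j)) =
        (\<Sum>j<N. \<Sum>l<d. D $$ (i, j) * (G $$ (i, l) * X $$ (l, j)))"
      using i by (simp add: F_index sum_distrib_left)
    also have "\<dots> = (\<Sum>l<d. \<Sum>j<N. D $$ (i, j) * (G $$ (i, l) * X $$ (l, j)))"
      by (rule sum.swap)
    also have "\<dots> = (\<Sum>l<d. G $$ (i, l) * (\<Sum>j<N. D $$ (i, j) * X $$ (l, j)))"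
      by (simp add: sum_distrib_left mult_ac)
    also have "\<dots> = (\<Sum>l<d. (G $$ (i, l))\<^sup>2)"
      using i by (simp add: G_index[symmetric] power2_eq_square)
    finally show "(\<Sum>j<N. D $$ (i, j) * F $$ (i, j)) = (\<Sum>l<d. (G $$ (i, l))\<^sup>2)" .
  qed
  have "t * (2 * a) \<le> t\<^sup>2 * b" for t
  proof -
    have "R - (A + t \<cdot>\<^sub>m G) * X = D - t \<cdot>\<^sub>m F"
    proof -
      have "(A + t \<cdot>\<^sub>m G) * X = A * X + t \<cdot>\<^sub>m F"
        unfolding F_def using A G X by (simp add: add_mult_distrib_mat mult_smult_assoc_mat)
      moreover have "A * X \<in> carrier_mat p N"
        using A X by simp
      ultimately show ?thesis
        unfolding D_def using R F A X by (intro eq_matI) auto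
    qed
    then have "(frobenius_norm D)\<^sup>2 \<le> (frobenius_norm (D - t \<cdot>\<^sub>m F))\<^sup>2"
      using le[of "A + t \<cdot>\<^sub>m G"] A G unfolding D_def by simp
    also have "(frobenius_norm (D - t \<cdot>\<^sub>m F))\<^sup>2 =
        (\<Sum>i<p. \<Sum>j<N. (D $$ (i, j) - t * F $$ (i, j))\<^sup>2)"
      unfolding frobenius_norm_sq using D F by simp
    also have "\<dots> = (\<Sum>i<p. \<Sum>j<N. (D $$ (i, j))\<^sup>2 + (t\<^sup>2 * (F $$ (i, j))\<^sup>2 - 2 * t * (D $$ (i, j) * F $$ (i, j))))"
      by (intro sum.cong refl) (simp add: power2_diff power_mult_distrib)
    also have "\<dots> = (frobenius_norm D)\<^sup>2 + (t\<^sup>2 * b - 2 * t * a)"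
      unfolding frobenius_norm_sq a_def b_def using D
      by (simp add: sum.distrib sum_subtractf sum_distrib_left)
    finally show ?thesis
      by simp
  qed
  then have "a = 0"
    using linear_le_quadratic_imp_zero[of "2 * a" b] by simp
  then have "G $$ (i, l) = 0" if "i < p" "l < d" for i l
    using that unfolding a_eq by (simp add: sum_nonneg_eq_0_iff sum_nonneg)
  then have "G = 0\<^sub>m p d"
    using G by (intro eq_matI) auto
  moreover have "G = R * X\<^sup>T - A * (X * X\<^sup>T)"
    unfolding G_def D_def using R A X by (simp add: minus_mult_distrib_mat[of _ p N])
  ultimately have "R * X\<^sup>T - A * (X * X\<^sup>T) = 0\<^sub>m p d"
    by simp
  then have "(R * X\<^sup>T - A * (X * X\<^sup>T)) $$ (i, l) = 0" if "i < p" "l < d" for i l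
    using that by simp
  then show ?thesis
    using R A X by (intro eq_matI) auto
qed

text \<open>
  The determinants of the two sides of \<open>(W * A) * (X * X\<^sup>T) = L * (W * U)\<close> give both
  conclusions at once: invertibility of \<open>X * X\<^sup>T\<close> makes \<open>A\<close> and \<open>M * U\<close> differ by an
  invertible right factor.
\<close>

lemma least_squares_step:
  fixes R U W L A :: "real mat"
  assumes R: "R \<in> carrier_mat p N" and U: "U \<in> carrier_mat p d"
    and W: "W \<in> carrier_mat d p" and L: "L \<in> carrier_mat d d"
    and WM: "W * (R * R\<^sup>T) = L * W" and detL: "det L \<noteq> 0" and detU: "det (W * U) \<noteq> 0"
    and min: "is_arg_min (\<lambda>A. (frobenius_norm (R - A * (U\<^sup>T * R)))\<^sup>2) (\<lambda>A. A \<in> carrier_mat p d) A"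
  shows "Col A = Col (R * R\<^sup>T * U)" and "det (W * A) \<noteq> 0"
proof -
  define X where "X = U\<^sup>T * R"
  have X: "X \<in> carrier_mat d N"
    unfolding X_def using U R by simp
  have XT: "X\<^sup>T = R\<^sup>T * U"
    unfolding X_def using U R by (simp add: transpose_mult[of _ d p _ N])
  have A: "A \<in> carrier_mat p d"
    using min unfolding is_arg_min_linorder by auto
  have S: "X * X\<^sup>T \<in> carrier_mat d d"
    using X by simp
  have M: "R * R\<^sup>T \<in> carrier_mat p p"
    using R by simp
  have "A * (X * X\<^sup>T) = R * X\<^sup>T"
    using least_squares_normal_equations[OF R X] min unfolding X_def by simp
  also have "\<dots> = R * R\<^sup>T * U"
    unfolding XT using R U by (simp add: assoc_mult_mat[of _ p N])
  finally have AS: "A * (X * X\<^sup>T) = R * R\<^sup>T * U" .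
  have "(W * A) * (X * X\<^sup>T) = W * (A * (X * X\<^sup>T))"
    using W A S by (rule assoc_mult_mat)
  also have "\<dots> = (W * (R * R\<^sup>T)) * U"
    unfolding AS using assoc_mult_mat[OF W M U] by simp
  also have "\<dots> = L * (W * U)"
    unfolding WM using L W U by (rule assoc_mult_mat)
  finally have "(W * A) * (X * X\<^sup>T) = L * (W * U)" .
  then have "det (W * A) * det (X * X\<^sup>T) = det L * det (W * U)"
    using det_mult[of "W * A" d "X * X\<^sup>T"] det_mult[of L d "W * U"] W A S L U by simp
  then have nz: "det (W * A) * det (X * X\<^sup>T) \<noteq> 0"
    using detL detU by simp
  then show "det (W * A) \<noteq> 0"
    by simp
  from nz have "det (X * X\<^sup>T) \<noteq> 0"
    by simp
  from Col_mult_invertible[OF A S this] show "Col A = Col (R * R\<^sup>T * U)"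
    unfolding AS by simp
qed

section \<open>Principal components are eigenvectors with positive eigenvalue\<close>

lemma quadratic_form_le_if_le_on_unit:
  fixes M :: "real mat"
  assumes M: "M \<in> carrier_mat p p"
    and F: "\<And>v. v \<in> F \<Longrightarrow> v \<in> carrier_vec p"
    and le: "\<And>w. w \<in> carrier_vec p \<Longrightarrow> w \<bullet> w = 1 \<Longrightarrow> (\<And>v. v \<in> F \<Longrightarrow> w \<bullet> v = 0) \<Longrightarrow>
      w \<bullet> (M *\<^sub>v w) \<le> q"
    and w: "w \<in> carrier_vec p" and wF: "\<And>v. v \<in> F \<Longrightarrow> w \<bullet> v = 0"
  shows "w \<bullet> (M *\<^sub>v w) \<le> q * (w \<bullet> w)"
proof (cases "w = 0\<^sub>v p")
  case True
  then show ?thesis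
    using M by simp
next
  case False
  then have pos: "0 < w \<bullet> w"
    by (rule scalar_prod_self_pos[OF w])
  define s where "s = 1 / sqrt (w \<bullet> w)"
  have s: "s * s = 1 / (w \<bullet> w)"
    unfolding s_def using pos by (simp add: real_sqrt_mult_self)
  have "(s \<cdot>\<^sub>v w) \<bullet> (M *\<^sub>v (s \<cdot>\<^sub>v w)) \<le> q"
  proof (rule le)
    show "(s \<cdot>\<^sub>v w) \<bullet> (s \<cdot>\<^sub>v w) = 1"
      using w s pos by (simp add: mult.assoc[symmetric])
  next
    fix v assume "v \<in> F"
    then show "(s \<cdot>\<^sub>v w) \<bullet> v = 0"
      using w F wF by simp
  qed (use w in simp)
  moreover have "(s \<cdot>\<^sub>v w) \<bullet> (M *\<^sub>v (s \<cdot>\<^sub>v w)) = (s * s) * (w \<bullet> (M *\<^sub>v w))"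
    using M w by (simp add: mult_mat_vec[OF M w])
  ultimately show ?thesis
    unfolding s using pos by (simp add: field_simps)
qed

text \<open>
  Let \<open>q\<close> be the maximal value. The residual \<open>g = M u - q u\<close> is orthogonal to the eigenvectors
  in \<open>F\<close>, since \<open>M\<close> is symmetric and \<open>u\<close> is orthogonal to them; so \<open>u + t g\<close> is admissible
  after normalization. It is orthogonal to \<open>u\<close> as well, and then the first-order term of
  the form along \<open>u + t g\<close> is \<open>2 t\<close> times the squared norm of \<open>g\<close>, which must vanish.
\<close>

lemma constrained_maximizer_eigenvector:
  fixes M :: "real mat"
  assumes M: "M \<in> carrier_mat p p" and sym: "M\<^sup>T = M"
    and F: "\<And>v. v \<in> F \<Longrightarrow> v \<in> carrier_vec p" and eig: "\<And>v. v \<in> F \<Longrightarrow> M *\<^sub>v v = c v \<cdot>\<^sub>v v"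
    and u: "u \<in> carrier_vec p" and u1: "u \<bullet> u = 1" and uF: "\<And>v. v \<in> F \<Longrightarrow> u \<bullet> v = 0"
    and max: "\<And>w. w \<in> carrier_vec p \<Longrightarrow> w \<bullet> w = 1 \<Longrightarrow> (\<And>v. v \<in> F \<Longrightarrow> w \<bullet> v = 0) \<Longrightarrow>
      w \<bullet> (M *\<^sub>v w) \<le> u \<bullet> (M *\<^sub>v u)"
  shows "M *\<^sub>v u = (u \<bullet> (M *\<^sub>v u)) \<cdot>\<^sub>v u"
proof -
  define q where "q = u \<bullet> (M *\<^sub>v u)"
  define g where "g = M *\<^sub>v u - q \<cdot>\<^sub>v u"
  have Mu: "M *\<^sub>v u \<in> carrier_vec p"
    using M u by simp
  have g: "g \<in> carrier_vec p"
    unfolding g_def using Mu u by simp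
  have Mg: "M *\<^sub>v g \<in> carrier_vec p"
    using M g by simp
  have adj: "(M *\<^sub>v x) \<bullet> y = x \<bullet> (M *\<^sub>v y)" if "x \<in> carrier_vec p" "y \<in> carrier_vec p" for x y
    using transpose_vec_mult_scalar[OF M that(2,1)] unfolding sym .
  have max': "w \<bullet> (M *\<^sub>v w) \<le> q * (w \<bullet> w)"
    if "w \<in> carrier_vec p" "\<And>v. v \<in> F \<Longrightarrow> w \<bullet> v = 0" for w
    using quadratic_form_le_if_le_on_unit[OF M, where F = F and q = q and w = w] F max that unfolding q_def by blast
  have gu: "g \<bullet> u = 0"
    unfolding g_def using Mu u u1
    by (simp add: minus_scalar_prod_distrib[of _ p] adj q_def)
  have gF: "g \<bullet> v = 0" if v: "v \<in> F" for v
    unfolding g_def using Mu u F[OF v] uF[OF v]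
    by (simp add: minus_scalar_prod_distrib[of _ p] adj eig[OF v])
  have gMu: "g \<bullet> (M *\<^sub>v u) = g \<bullet> g"
  proof -
    have "M *\<^sub>v u = g + q \<cdot>\<^sub>v u"
      unfolding g_def using Mu u M by (intro eq_vecI) auto
    then have "g \<bullet> (M *\<^sub>v u) = g \<bullet> (g + q \<cdot>\<^sub>v u)"
      by simp
    also have "\<dots> = g \<bullet> g"
      using g u gu by (simp add: scalar_prod_add_distrib[of _ p])
    finally show ?thesis .
  qed
  have uMg: "u \<bullet> (M *\<^sub>v g) = g \<bullet> g"
    using adj[OF u g] comm_scalar_prod[OF Mu g] gMu by simp
  have ug: "u \<bullet> g = 0"
    using gu comm_scalar_prod[OF g u] by simp
  have "t * (2 * (g \<bullet> g)) \<le> t\<^sup>2 * (q * (g \<bullet> g) - g \<bullet> (M *\<^sub>v g))" for t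
  proof -
    define w where "w = u + t \<cdot>\<^sub>v g"
    have w: "w \<in> carrier_vec p"
      unfolding w_def using u g by simp
    have "w \<bullet> v = 0" if v: "v \<in> F" for v
      unfolding w_def using u g F[OF v] uF[OF v] gF[OF v]
      by (simp add: add_scalar_prod_distrib[of _ p])
    from max'[OF w this] have "w \<bullet> (M *\<^sub>v w) \<le> q * (w \<bullet> w)" .
    moreover have "w \<bullet> w = 1 + t\<^sup>2 * (g \<bullet> g)"
      unfolding w_def using u g u1 gu ug
      by (simp add: add_scalar_prod_distrib[of _ p] scalar_prod_add_distrib[of _ p] power2_eq_square)
    moreover have "w \<bullet> (M *\<^sub>v w) = q + t * (2 * (g \<bullet> g)) + t\<^sup>2 * (g \<bullet> (M *\<^sub>v g))"
    proof -
      have "M *\<^sub>v w = M *\<^sub>v u + t \<cdot>\<^sub>v (M *\<^sub>v g)"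
        unfolding w_def using M u g
        by (simp add: mult_add_distrib_mat_vec[of _ p p] mult_mat_vec[OF M g])
      then show ?thesis
        unfolding w_def using u g Mu Mg uMg gMu
        by (simp add: add_scalar_prod_distrib[of _ p] scalar_prod_add_distrib[of _ p]
            power2_eq_square q_def algebra_simps)
    qed
    ultimately show ?thesis
      by (simp add: algebra_simps)
  qed
  from linear_le_quadratic_imp_zero[OF this] have "g \<bullet> g = 0"
    by simp
  then have "g = 0\<^sub>v p"
    using scalar_prod_self_pos[OF g] by fastforce
  then have "M *\<^sub>v u - q \<cdot>\<^sub>v u = 0\<^sub>v p"
    unfolding g_def .
  then have "(M *\<^sub>v u - q \<cdot>\<^sub>v u) $ i = 0" if "i < p" for i
    using that by simp
  then show ?thesis
    unfolding q_def[symmetric] using Mu u M by (intro eq_vecI) auto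
qed


text \<open>
  This is the part of ``rank at least the number of nonzero eigenvalues'' that the positivity
  of the form below needs.
  The Schur decomposition \<open>M = P * B * Q\<close> with the eigenvalues on the diagonal of \<open>B\<close> in the
  listed order makes the leading \<open>d\<close> by \<open>d\<close> block of \<open>B\<close> triangular with nonzero diagonal, so
  \<open>B\<close> kills no nonzero vector supported on the first \<open>d\<close> coordinates. Fewer than \<open>d\<close> linear
  conditions have a nonzero solution among such vectors.
\<close>

lemma exists_orthogonal_vec_not_in_kernel:
  fixes M :: "real mat" and f :: "nat \<Rightarrow> real vec"
  assumes M: "M \<in> carrier_mat p p"
    and cp: "char_poly M = (\<Prod>e\<leftarrow>es. [:- e, 1:])"
    and nz: "\<And>i. i < d \<Longrightarrow> es ! i \<noteq> 0"
    and f: "\<And>i. i < k \<Longrightarrow> f i \<in> carrier_vec p"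
    and kd: "k < d" and dp: "d \<le> p"
  shows "\<exists>w \<in> carrier_vec p. (\<forall>i<k. w \<bullet> f i = 0) \<and> M *\<^sub>v w \<noteq> 0\<^sub>v p"
proof -
  obtain B P Q where BPQ: "schur_decomposition M es = (B, P, Q)"
    by (cases "schur_decomposition M es") auto
  from schur_decomposition[OF M cp BPQ]
  have sim: "similar_mat_wit M B P Q" and ut: "upper_triangular B" and diag: "diag_mat B = es"
    by auto
  from similar_mat_witD2[OF M sim]
  have PQ: "P * Q = 1\<^sub>m p" and QP: "Q * P = 1\<^sub>m p" and MB: "M = P * B * Q"
    and B: "B \<in> carrier_mat p p" and P: "P \<in> carrier_mat p p" and Q: "Q \<in> carrier_mat p p"
    by auto
  \<comment> \<open>The rows of \<open>K\<close> encode orthogonality of \<open>P y\<close> to the \<open>f i\<close> and vanishing of the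
    coordinates of \<open>y\<close> from \<open>d\<close> on. As \<open>k < d\<close>, row \<open>k\<close> is free to be zero, so \<open>K\<close> is singular.\<close>
  define c where "c = (\<lambda>i. if i < k then P\<^sup>T *\<^sub>v f i else if i < d then 0\<^sub>v p else unit_vec p i)"
  define K where "K = mat\<^sub>r p p (\<lambda>i. if i = k then 0\<^sub>v p else c i)"
  have K: "K \<in> carrier_mat p p"
    unfolding K_def by simp
  have c: "c i \<in> carrier_vec p" for i
    unfolding c_def using P f by (auto intro!: mult_mat_vec_carrier[of _ p p])
  have "det K = 0"
    unfolding K_def using kd dp c by (intro det_row_0) auto
  then obtain y where y: "y \<in> carrier_vec p" "y \<noteq> 0\<^sub>v p" "K *\<^sub>v y = 0\<^sub>v p"
    using det_0_iff_vec_prod_zero_field[OF K] by blast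
  have Ky: "c i \<bullet> y = 0" if "i < p" "i \<noteq> k" for i
  proof -
    have "(K *\<^sub>v y) $ i = c i \<bullet> y"
      using that K c unfolding K_def by simp
    then show ?thesis
      using y that by simp
  qed
  have y_tail: "y $ i = 0" if "d \<le> i" "i < p" for i
    using Ky[of i] that kd y unfolding c_def by simp
  define w where "w = P *\<^sub>v y"
  have w: "w \<in> carrier_vec p"
    unfolding w_def using P y by simp
  have "w \<bullet> f i = 0" if i: "i < k" for i
  proof -
    have "w \<bullet> f i = f i \<bullet> (P *\<^sub>v y)"
      using comm_scalar_prod[OF w f[OF i]] unfolding w_def .
    also have "\<dots> = (P\<^sup>T *\<^sub>v f i) \<bullet> y"
      using transpose_vec_mult_scalar[OF P y(1) f[OF i]] by simp
    also have "\<dots> = 0"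
      using Ky[of i] i kd dp unfolding c_def by simp
    finally show ?thesis .
  qed
  moreover have "M *\<^sub>v w \<noteq> 0\<^sub>v p"
  proof
    assume Mw: "M *\<^sub>v w = 0\<^sub>v p"
    have "Q *\<^sub>v w = (Q * P) *\<^sub>v y"
      unfolding w_def using Q P y by simp
    then have Qw: "Q *\<^sub>v w = y"
      unfolding QP using y by simp
    have "M *\<^sub>v w = (P * B) *\<^sub>v (Q *\<^sub>v w)"
      unfolding MB using mult_carrier_mat[OF P B] Q w by (rule assoc_mult_mat_vec)
    also have "\<dots> = P *\<^sub>v (B *\<^sub>v (Q *\<^sub>v w))"
      using P B mult_mat_vec_carrier[OF Q w] by (rule assoc_mult_mat_vec)
    finally have "M *\<^sub>v w = P *\<^sub>v (B *\<^sub>v (Q *\<^sub>v w))" .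
    then have "P *\<^sub>v (B *\<^sub>v y) = 0\<^sub>v p"
      using Mw unfolding Qw by simp
    then have "(Q * P) *\<^sub>v (B *\<^sub>v y) = Q *\<^sub>v 0\<^sub>v p"
      using P Q B y by (simp add: assoc_mult_mat_vec[of _ p p])
    then have By: "B *\<^sub>v y = 0\<^sub>v p"
      unfolding QP using B Q y by (auto intro!: eq_vecI)
    \<comment> \<open>At the last nonzero coordinate of \<open>y\<close>, triangularity leaves only the diagonal entry.\<close>
    define m where "m = Max {i. i < p \<and> y $ i \<noteq> 0}"
    have ne: "{i. i < p \<and> y $ i \<noteq> 0} \<noteq> {}"
    proof
      assume "{i. i < p \<and> y $ i \<noteq> 0} = {}"
      then have "y = 0\<^sub>v p"
        using y by (intro eq_vecI) auto
      with y show False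
        by simp
    qed
    have fin: "finite {i. i < p \<and> y $ i \<noteq> 0}"
      by simp
    have m: "m < p" "y $ m \<noteq> 0"
      using Max_in[OF fin ne] unfolding m_def by auto
    have above: "y $ j = 0" if "m < j" "j < p" for j
      using that Max_ge[OF fin, of j] unfolding m_def[symmetric] by fastforce
    have md: "m < d"
      using y_tail m by (meson not_le)
    have off_diag: "B $$ (m, j) * y $ j = 0" if "j < p" "j \<noteq> m" for j
      using that above ut m B unfolding upper_triangular_def
      by (cases "j < m") auto
    have "(B *\<^sub>v y) $ m = (\<Sum>j<p. B $$ (m, j) * y $ j)"
      using B y m by (simp add: scalar_prod_def atLeast0LessThan)
    also have "\<dots> = B $$ (m, m) * y $ m + (\<Sum>j\<in>{..<p} - {m}. B $$ (m, j) * y $ j)"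
      using m by (intro sum.remove) auto
    also have "(\<Sum>j\<in>{..<p} - {m}. B $$ (m, j) * y $ j) = 0"
      by (rule sum.neutral) (use off_diag in blast)
    finally have "B $$ (m, m) * y $ m = 0"
      using By m by simp
    moreover have "B $$ (m, m) = es ! m"
      using m B unfolding diag[symmetric] diag_mat_def by simp
    ultimately show False
      using nz[OF md] m by simp
  qed
  ultimately show ?thesis
    using w by blast
qed

text \<open>
  By induction the earlier components are eigenvectors, so \<open>constrained_maximizer_eigenvector\<close>
  applies to \<open>PC k\<close>, and its eigenvalue is the maximum of the form over the unit vectors
  orthogonal to them. That maximum is positive because \<open>M = R * R\<^sup>T\<close> does not vanish on their
  orthogonal complement: the form at \<open>w\<close> is the squared norm of \<open>R\<^sup>T w\<close>, which is zero only if \<open>M w = 0\<close>.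
\<close>

lemma principal_component_eigenvector:
  assumes R: "R \<in> carrier_mat p N" and dp: "d \<le> p"
    and pc: "is_principal_components R d PC"
    and cp: "char_poly (R * R\<^sup>T) = (\<Prod>e\<leftarrow>es. [:- e, 1:])"
    and nz: "\<And>i. i < d \<Longrightarrow> es ! i \<noteq> 0"
    and k: "k \<in> {1..d}"
  shows "PC k \<in> carrier_vec p \<and> (\<exists>l>0. (R * R\<^sup>T) *\<^sub>v PC k = l \<cdot>\<^sub>v PC k)"
  using k
proof (induction k rule: less_induct)
  case (less k)
  define M where "M = R * R\<^sup>T"
  have M: "M \<in> carrier_mat p p"
    unfolding M_def using R by simp
  have sym: "M\<^sup>T = M"
    unfolding M_def using R by (simp add: transpose_mult[of _ p N _ p])
  have RT: "R\<^sup>T \<in> carrier_mat N p"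
    using R by simp
  have q_eq: "(euclidean_norm (R\<^sup>T *\<^sub>v w))\<^sup>2 = w \<bullet> (M *\<^sub>v w)" if w: "w \<in> carrier_vec p" for w
  proof -
    have "(R\<^sup>T *\<^sub>v w) \<bullet> (R\<^sup>T *\<^sub>v w) = w \<bullet> (R *\<^sub>v (R\<^sup>T *\<^sub>v w))"
      using transpose_vec_mult_scalar[OF R _ w] RT w by simp
    then show ?thesis
      unfolding euclidean_norm_sq M_def using R RT w by simp
  qed
  define F where "F = PC ` {1..<k}"
  have IH: "PC i \<in> carrier_vec p" "\<exists>l>0. M *\<^sub>v PC i = l \<cdot>\<^sub>v PC i" if "i \<in> {1..<k}" for i
    using less.IH[of i] that less.prems unfolding M_def by auto
  have F: "F \<subseteq> carrier_vec p"
    unfolding F_def using IH by auto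
  interpret vec_space "TYPE(real)" p .
  have span_iff: "(\<forall>v\<in>span F. w \<bullet> v = 0) \<longleftrightarrow> (\<forall>v\<in>F. w \<bullet> v = 0)" if "w \<in> carrier_vec p" for w
    using in_orthogonal_complement_span[OF F] that unfolding orthogonal_complement_def by blast
  define u where "u = PC k"
  have "is_arg_max (\<lambda>w. (euclidean_norm (R\<^sup>T *\<^sub>v w))\<^sup>2)
      (\<lambda>w. w \<in> carrier_vec p \<and> euclidean_norm w = 1 \<and> (\<forall>v\<in>span F. w \<bullet> v = 0)) u"
    using pc less.prems R unfolding is_principal_components_def F_def u_def by auto
  then have u: "u \<in> carrier_vec p" and u1: "u \<bullet> u = 1" and uF: "\<And>v. v \<in> F \<Longrightarrow> u \<bullet> v = 0"
    and max: "\<And>w. w \<in> carrier_vec p \<Longrightarrow> w \<bullet> w = 1 \<Longrightarrow> (\<And>v. v \<in> F \<Longrightarrow> w \<bullet> v = 0) \<Longrightarrow>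
      w \<bullet> (M *\<^sub>v w) \<le> u \<bullet> (M *\<^sub>v u)"
    unfolding is_arg_max_linorder euclidean_norm_eq_1_iff by (auto simp: q_eq[symmetric] span_iff)
  have "\<forall>v\<in>F. \<exists>l. M *\<^sub>v v = l \<cdot>\<^sub>v v"
    unfolding F_def using IH(2) by blast
  then obtain c where c: "\<And>v. v \<in> F \<Longrightarrow> M *\<^sub>v v = c v \<cdot>\<^sub>v v"
    by metis
  define q where "q = u \<bullet> (M *\<^sub>v u)"
  have eig: "M *\<^sub>v u = q \<cdot>\<^sub>v u"
    unfolding q_def by (rule constrained_maximizer_eigenvector[OF M sym _ c u u1 uF max]) (use F in auto)
  have k: "k - 1 < d" "0 < k"
    using less.prems by auto
  obtain w where w: "w \<in> carrier_vec p" and wPC: "\<forall>i<k - 1. w \<bullet> PC (Suc i) = 0"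
    and Mw: "M *\<^sub>v w \<noteq> 0\<^sub>v p"
    using exists_orthogonal_vec_not_in_kernel[OF M, of es d "k - 1" "\<lambda>i. PC (Suc i)"]
      cp nz IH(1) k dp unfolding M_def by auto
  have wF: "w \<bullet> v = 0" if v: "v \<in> F" for v
  proof -
    obtain i where "i \<in> {1..<k}" "v = PC i"
      using v unfolding F_def by blast
    then show ?thesis
      using wPC[rule_format, of "i - 1"] by auto
  qed
  have RTw: "R\<^sup>T *\<^sub>v w \<in> carrier_vec N"
    using RT w by simp
  have "R\<^sup>T *\<^sub>v w \<noteq> 0\<^sub>v N"
  proof
    assume "R\<^sup>T *\<^sub>v w = 0\<^sub>v N"
    then have "M *\<^sub>v w = R *\<^sub>v 0\<^sub>v N"
      unfolding M_def using R RT w by simp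
    also have "\<dots> = 0\<^sub>v p"
      using R by (intro eq_vecI) auto
    finally show False
      using Mw by simp
  qed
  then have "0 < w \<bullet> (M *\<^sub>v w)"
    using scalar_prod_self_pos[OF RTw] unfolding q_eq[OF w, symmetric] euclidean_norm_sq by simp
  also have "\<dots> \<le> q * (w \<bullet> w)"
    using quadratic_form_le_if_le_on_unit[OF M _ _ w wF, where q = q] F max unfolding q_def by blast
  finally have "0 < q * (w \<bullet> w)" .
  moreover have "0 \<le> w \<bullet> w"
    using euclidean_norm_sq[of w] by (metis zero_le_power2)
  ultimately have "0 < q"
    by (simp add: zero_less_mult_iff)
  then show ?case
    using u eig unfolding u_def M_def by blast
qed

section \<open>Equality of the column spaces\<close>

theorem theorem1:
  fixes p d N :: nat
    and R U0 :: "real mat"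
    and \<sigma> :: "nat \<Rightarrow> real"
    and PC :: "nat \<Rightarrow> real vec"
    and U_LS :: "nat \<Rightarrow> real mat"
  assumes "0 < p" and "0 < d" and "0 < N"
    and "d < p" and "p < N"
    and "R \<in> carrier_mat p N"
    and "is_singular_values R \<sigma>"
    and "\<sigma> (d + 1) < \<sigma> d"
    and "is_principal_components R d PC"
    and "U0 \<in> carrier_mat p d"
    and "mat_rank (U0\<^sup>T * pc_matrix p d PC) = d"
    and "is_least_squares_iterates R U0 U_LS"
  shows "\<forall>k. Col (U_LS k) = Col (subspace_iterates (R * R\<^sup>T) U0 k)"
proof -
  note R = assms(6) and U0 = assms(10)
  define M where "M = R * R\<^sup>T"
  have M: "M \<in> carrier_mat p p"
    unfolding M_def using R by simp
  have sym: "M\<^sup>T = M"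
    unfolding M_def using R by (simp add: transpose_mult[of _ p N _ p])
  define es where "es = map (\<lambda>i. (\<sigma> i)\<^sup>2) [1..<p + 1]"
  have sv: "\<forall>i\<in>{1..p}. 0 \<le> \<sigma> i" "\<forall>i\<in>{1..p}. \<forall>j\<in>{1..p}. i \<le> j \<longrightarrow> \<sigma> j \<le> \<sigma> i"
    and cp: "char_poly M = (\<Prod>i\<in>{1..p}. [:- ((\<sigma> i)\<^sup>2), 1:])"
    using assms(7) R unfolding is_singular_values_def M_def by auto
  have cp': "char_poly M = (\<Prod>e\<leftarrow>es. [:- e, 1:])"
  proof -
    have "(\<Prod>e\<leftarrow>es. [:- e, 1:]) = (\<Prod>i\<leftarrow>[1..<p + 1]. [:- ((\<sigma> i)\<^sup>2), 1:])"
      unfolding es_def by (simp add: comp_def)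
    also have "\<dots> = (\<Prod>i\<in>set [1..<p + 1]. [:- ((\<sigma> i)\<^sup>2), 1:])"
      by (rule prod.distinct_set_conv_list[symmetric]) simp
    also have "set [1..<p + 1] = {1..p}"
      by auto
    finally show ?thesis
      unfolding cp by simp
  qed
  have \<sigma>_pos: "0 < \<sigma> i" if "i \<in> {1..d}" for i
  proof -
    have "0 \<le> \<sigma> (d + 1)"
      using sv(1) \<open>d < p\<close> by auto
    also have "\<dots> < \<sigma> d"
      by (rule assms(8))
    also have "\<dots> \<le> \<sigma> i"
      using sv(2) that \<open>d < p\<close> by auto
    finally show ?thesis .
  qed
  have es_nz: "es ! i \<noteq> 0" if "i < d" for i
    using \<sigma>_pos[of "i + 1"] that \<open>d < p\<close> unfolding es_def by (simp del: upt_Suc)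
  have "\<forall>k\<in>{1..d}. \<exists>l. PC k \<in> carrier_vec p \<and> 0 < l \<and> M *\<^sub>v PC k = l \<cdot>\<^sub>v PC k"
    using principal_component_eigenvector[OF R less_imp_le[OF \<open>d < p\<close>] assms(9) cp'[unfolded M_def] es_nz]
    unfolding M_def by blast
  then obtain l where l: "\<And>k. k \<in> {1..d} \<Longrightarrow> PC k \<in> carrier_vec p"
    "\<And>k. k \<in> {1..d} \<Longrightarrow> 0 < l k" "\<And>k. k \<in> {1..d} \<Longrightarrow> M *\<^sub>v PC k = l k \<cdot>\<^sub>v PC k"
    by metis
  define V where "V = pc_matrix p d PC"
  define W where "W = V\<^sup>T"
  define L where "L = mat_diag d (\<lambda>i. l (Suc i))"
  have V: "V \<in> carrier_mat p d"
    using mat_of_cols_carrier(1)[of p "map PC [1..<d + 1]"] unfolding V_def pc_matrix_def by (simp del: upt_Suc)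
  have W: "W \<in> carrier_mat d p"
    unfolding W_def using V by simp
  have L: "L \<in> carrier_mat d d"
    unfolding L_def by simp
  have colV: "col V i = PC (Suc i)" if "i < d" for i
    using that l(1)[of "Suc i"] unfolding V_def pc_matrix_def
    by (simp del: upt_Suc)
  have detL: "det L \<noteq> 0"
    unfolding L_def det_mat_diag using l(2) by (auto simp: less_le)
  \<comment> \<open>The eigenvector equations, and after transposing, the relation that the step uses.\<close>
  have MV: "M * V = V * L"
  proof (rule mat_col_eqI)
    fix i assume "i < dim_col (V * L)"
    then have i: "i < d"
      using L by simp
    have "col (M * V) i = l (Suc i) \<cdot>\<^sub>v col V i"
      using l(3)[of "Suc i"] i unfolding col_mult2[OF M V i] colV[OF i] by simp
    also have "\<dots> = col (V * L) i"
      using i V unfolding L_def mat_diag_mult_right[OF V] by (intro eq_vecI) auto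
    finally show "col (M * V) i = col (V * L) i" .
  qed (use M V L in auto)
  have LT: "L\<^sup>T = L"
    unfolding L_def mat_diag_def by (intro eq_matI) auto
  have WM: "W * M = L * W"
    using arg_cong[OF MV, of transpose_mat] transpose_mult[OF M V] transpose_mult[OF V L]
    unfolding W_def sym LT by simp
  have "W * U0 = (U0\<^sup>T * V)\<^sup>T"
    unfolding W_def using U0 V by (simp add: transpose_mult[of _ d p _ d])
  then have "det (W * U0) = det (U0\<^sup>T * V)"
    using U0 V by (simp add: det_transpose[of _ d])
  moreover have "det (U0\<^sup>T * V) \<noteq> 0"
    using vec_space.det_rank_iff[of "U0\<^sup>T * V" d] assms(11) U0 V unfolding V_def by simp
  ultimately have detU0: "det (W * U0) \<noteq> 0"
    by simp
  define S where "S = subspace_iterates M U0"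
  have "U_LS k \<in> carrier_mat p d \<and> S k \<in> carrier_mat p d \<and>
      det (W * U_LS k) \<noteq> 0 \<and> Col (U_LS k) = Col (S k)" for k
  proof (induction k)
    case 0
    then show ?case
      using assms(12) U0 detU0 unfolding is_least_squares_iterates_def S_def by simp
  next
    case (Suc k)
    then have U: "U_LS k \<in> carrier_mat p d" and Sk: "S k \<in> carrier_mat p d"
      and detU: "det (W * U_LS k) \<noteq> 0" and Col: "Col (U_LS k) = Col (S k)"
      by auto
    obtain A where min: "is_arg_min (\<lambda>A. (frobenius_norm (R - A * ((U_LS k)\<^sup>T * R)))\<^sup>2)
          (\<lambda>A. A \<in> carrier_mat p d) A"
      and U_Suc: "U_LS (Suc k) = GS A"
      using assms(12) R U0 unfolding is_least_squares_iterates_def Let_def by fastforce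
    have A: "A \<in> carrier_mat p d"
      using min unfolding is_arg_min_linorder by auto
    note step = least_squares_step[OF R U W L WM[unfolded M_def] detL detU min, folded M_def]
    have MS: "M * S k \<in> carrier_mat p d"
      using M Sk by simp
    have "Col A = Col (M * S k)"
      unfolding step(1) Col_mult[OF M U] Col_mult[OF M Sk] Col ..
    with step(2) have detS: "det (W * (M * S k)) \<noteq> 0"
      using det_mult_nonzero_Col_cong[OF W A MS] by blast
    have S_Suc: "S (Suc k) = GS (M * S k)"
      unfolding S_def by simp
    have Col_U: "Col (U_LS (Suc k)) = Col A"
      unfolding U_Suc by (rule Col_GS[OF W A step(2)])
    have U': "U_LS (Suc k) \<in> carrier_mat p d"
      unfolding U_Suc by (rule GS_carrier[OF W A step(2)])
    have "S (Suc k) \<in> carrier_mat p d"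
      unfolding S_Suc by (rule GS_carrier[OF W MS detS])
    moreover have "Col (U_LS (Suc k)) = Col (S (Suc k))"
      unfolding Col_U S_Suc Col_GS[OF W MS detS] by fact
    moreover have "det (W * U_LS (Suc k)) \<noteq> 0"
      using det_mult_nonzero_Col_cong[OF W A U'] Col_U step(2) by simp
    ultimately show ?case
      using U' by blast
  qed
  then show ?thesis
    unfolding S_def M_def by blast
qed

end
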